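(* Let $G$ be a graph with $m$ edges. If $\lambda(G)\ge\sqrt{m}$, then $$t(G)\ge \left\lfloor\frac{\sqrt{m}-1}{2}\right\rfloor,$$ unless $G$ is a complete bipartite graph (possibly together with some isolated vertices).
   Context: All graphs are finite, simple and undirected. For a graph $G$, $\lambda(G)$ denotes the spectral radius of $G$, i.e. the maximum of the moduli of the eigenvalues of the adjacency matrix $A(G)$, and $t(G)$ denotes the number of triangles (copies of $K_3$) in $G$. *)

theory Defs
  imports
    Complex_Main
    "Graph_Theory.Pair_Digraph"
    "Graph_Theory.Kuratowski"
    "Jordan_Normal_Form.Spectral_Radius"
begin

text \<open>
  A finite simple graph is a \<^locale>\<open>pair_graph\<close>: a finite vertex set
  with a symmetric, irreflexive set of arcs. Every undirected edge is represented by its two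
  orientations, so edges have to be counted as unordered pairs and not as arcs.
\<close>

definition edges :: "'a pair_pre_digraph \<Rightarrow> 'a set set" where
  "edges G = {{u, v} | u v. (u, v) \<in> parcs G}"

definition triangles :: "'a pair_pre_digraph \<Rightarrow> 'a pair_pre_digraph set" where
  "triangles G = {H. subgraph (with_proj H) (with_proj G) \<and> complete_digraph 3 (with_proj H)}"

definition adjacency_mat :: "'a list \<Rightarrow> 'a pair_pre_digraph \<Rightarrow> complex mat" where
  "adjacency_mat vs G = mat (length vs) (length vs)
     (\<lambda>(i, j). if (vs ! i, vs ! j) \<in> parcs G then 1 else 0)"

text \<open>
  Matrices are indexed by natural numbers, so the adjacency matrix depends on an enumeration of
  the vertices. The choice is irrelevant (lemma \<open>graph_spectral_radius_eq\<close> below). For the graph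
  without vertices the value is unspecified.
\<close>

definition graph_spectral_radius :: "'a pair_pre_digraph \<Rightarrow> real" where
  "graph_spectral_radius G =
     spectral_radius (adjacency_mat (SOME vs. distinct vs \<and> set vs = pverts G) G)"

text \<open>
  Here \<open>H\<close> is the complete bipartite graph, with both parts nonempty, and the vertices in
  \<open>pverts G - pverts H\<close> are the isolated ones.
\<close>

definition complete_bipartite_plus_isolated :: "'a pair_pre_digraph \<Rightarrow> bool" where
  "complete_bipartite_plus_isolated G \<longleftrightarrow>
     (\<exists>a b H. a \<ge> 1 \<and> b \<ge> 1 \<and> complete_bipartite_digraph a b (with_proj H)
        \<and> pverts H \<subseteq> pverts G \<and> parcs G = parcs H)"

lemma eigenvalue_adjacency_mat_iff:
  assumes "distinct vs" and "set vs = V"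
  shows "eigenvalue (adjacency_mat vs G) k \<longleftrightarrow>
    (\<exists>f. (\<exists>x\<in>V. f x \<noteq> 0) \<and>
         (\<forall>x\<in>V. (\<Sum>y\<in>V. (if (x, y) \<in> parcs G then 1 else 0) * f y) = k * f x))"
proof -
  let ?n = "length vs"
  let ?A = "adjacency_mat vs G"
  have bij: "bij_betw ((!) vs) {0..<?n} V"
    using assms bij_betw_nth[of vs "{0..<?n}" V] by (simp add: atLeast0LessThan)
  have rw: "(?A *\<^sub>v v) $ i = (\<Sum>y\<in>V. (if (vs ! i, y) \<in> parcs G then 1 else 0) * f y)"
    if "i < ?n" "v \<in> carrier_vec ?n" "\<And>j. j < ?n \<Longrightarrow> v $ j = f (vs ! j)" for v f i
  proof -
    have "(?A *\<^sub>v v) $ i = (\<Sum>j\<in>{0..<?n}. (if (vs ! i, vs ! j) \<in> parcs G then 1 else 0) * f (vs ! j))"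
      using that by (auto simp: adjacency_mat_def scalar_prod_def intro!: sum.cong)
    also have "\<dots> = (\<Sum>y\<in>V. (if (vs ! i, y) \<in> parcs G then 1 else 0) * f y)"
      by (rule sum.reindex_bij_betw[OF bij])
    finally show ?thesis .
  qed
  show ?thesis
  proof
    assume "eigenvalue ?A k"
    then obtain v where v: "v \<in> carrier_vec ?n" "v \<noteq> 0\<^sub>v ?n" "?A *\<^sub>v v = k \<cdot>\<^sub>v v"
      by (auto simp: eigenvalue_def eigenvector_def adjacency_mat_def)
    define f where "f x = v $ (the_inv_into {0..<?n} ((!) vs) x)" for x
    have f: "v $ j = f (vs ! j)" if "j < ?n" for j
      using that bij by (simp add: f_def bij_betw_def the_inv_into_f_f)
    obtain i where "i < ?n" "v $ i \<noteq> 0"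
      using v(1,2) by (metis carrier_vecD eq_vecI index_zero_vec)
    then have "\<exists>x\<in>V. f x \<noteq> 0"
      using f assms(2) by (metis nth_mem)
    moreover have "(\<Sum>y\<in>V. (if (x, y) \<in> parcs G then 1 else 0) * f y) = k * f x"
      if x: "x \<in> V" for x
    proof -
      obtain i where i: "i < ?n" "x = vs ! i"
        using x by (auto simp: assms(2)[symmetric] in_set_conv_nth)
      have "(?A *\<^sub>v v) $ i = k * f x"
        unfolding v(3) using v(1) i(1) by (simp add: f i(2))
      then show ?thesis
        using rw[OF i(1) v(1) f] by (simp only: i(2))
    qed
    ultimately show "\<exists>f. (\<exists>x\<in>V. f x \<noteq> 0) \<and>
         (\<forall>x\<in>V. (\<Sum>y\<in>V. (if (x, y) \<in> parcs G then 1 else 0) * f y) = k * f x)"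
      by blast
  next
    assume "\<exists>f. (\<exists>x\<in>V. f x \<noteq> 0) \<and>
         (\<forall>x\<in>V. (\<Sum>y\<in>V. (if (x, y) \<in> parcs G then 1 else 0) * f y) = k * f x)"
    then obtain f where f: "\<exists>x\<in>V. f x \<noteq> 0"
      "\<And>x. x \<in> V \<Longrightarrow> (\<Sum>y\<in>V. (if (x, y) \<in> parcs G then 1 else 0) * f y) = k * f x"
      by blast
    define v where "v = vec ?n (\<lambda>i. f (vs ! i))"
    have v: "v \<in> carrier_vec ?n" "\<And>j. j < ?n \<Longrightarrow> v $ j = f (vs ! j)"
      by (simp_all add: v_def)
    obtain i where "i < ?n" "f (vs ! i) \<noteq> 0"
      using f(1) by (auto simp: assms(2)[symmetric] in_set_conv_nth)
    then have "v \<noteq> 0\<^sub>v ?n"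
      using v(2)[of i] by auto
    moreover have "?A *\<^sub>v v = k \<cdot>\<^sub>v v"
    proof (rule eq_vecI)
      fix i assume "i < dim_vec (k \<cdot>\<^sub>v v)"
      then have i: "i < ?n" by (simp add: v_def)
      then have "vs ! i \<in> V" using assms(2) by auto
      then show "(?A *\<^sub>v v) $ i = (k \<cdot>\<^sub>v v) $ i"
        using rw[OF i v] f(2) i v by simp
    qed (simp add: v_def adjacency_mat_def)
    ultimately show "eigenvalue ?A k"
      using v(1) by (auto simp: eigenvalue_def eigenvector_def adjacency_mat_def)
  qed
qed

lemma graph_spectral_radius_eq:
  assumes "distinct vs" and "set vs = pverts G"
  shows "graph_spectral_radius G = spectral_radius (adjacency_mat vs G)"
proof -
  define ws where "ws = (SOME ws. distinct ws \<and> set ws = pverts G)"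
  have ws: "distinct ws \<and> set ws = pverts G"
    unfolding ws_def by (rule someI[of _ vs]) (simp add: assms)
  have "spectrum (adjacency_mat ws G) = spectrum (adjacency_mat vs G)"
    using eigenvalue_adjacency_mat_iff[of ws "pverts G"] eigenvalue_adjacency_mat_iff[OF assms] ws
    unfolding spectrum_def by blast
  then show ?thesis
    by (simp add: graph_spectral_radius_def spectral_radius_def ws_def)
qed

end

theory Submission
  imports Defs "HOL-Analysis.Function_Topology"
begin

text \<open>
  Write \<open>t\<close> for the number of triangles. The proof shows slightly more than is claimed: if
  \<open>G\<close> has an edge, \<open>\<lambda>(G)\<close> is at least the root of \<open>m\<close> and \<open>G\<close> is not complete bipartite up to isolated vertices,
  then \<open>\<lambda>(G) \<le> 2 t + 2\<close>.

  A maximiser of the Rayleigh quotient of the adjacency matrix is a nonnegative eigenvector; its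
  eigenvalue \<open>l\<close> is at least \<open>\<lambda>(G)\<close>. Scale it to \<open>x\<close> with largest entry \<open>x r = 1\<close>, let \<open>U\<close> be
  the neighbourhood of \<open>r\<close> and \<open>W\<close> the set of the vertices outside \<open>U\<close> other than \<open>r\<close>. The sum of
  the \<open>x u\<close> over \<open>U\<close> is \<open>l\<close>, and applying the eigenvalue equation twice gives
  \<open>l\<^sup>2 = |U| + (\<Sum>u\<in>U. dU u * x u) + (\<Sum>w\<in>W. dU w * x w)\<close>, where \<open>dU\<close> and \<open>dW\<close> count neighbours
  in \<open>U\<close> and in \<open>W\<close>. Comparing this with \<open>m \<le> l\<^sup>2\<close> yields the central estimate
  (\<open>defect_inequality\<close>): the sum of \<open>x u + x v - 1\<close> over the edges \<open>uv\<close> inside \<open>U\<close> bounds the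
  number \<open>e\<^sub>W\<close> of edges inside \<open>W\<close> plus the total defect \<open>\<Sum>w\<in>W. dU w * (1 - x w)\<close>.

  If \<open>U\<close> spans no edge, then \<open>W\<close> spans none either, and every vertex of \<open>W\<close> that has a neighbour has
  weight 1, which forces it to be adjacent to all of \<open>U\<close>: the graph is complete bipartite
  (\<open>bipartite_if_no_edges_in_U\<close>).

  If \<open>U\<close> spans \<open>k \<ge> 1\<close> edges, let \<open>uv\<close> be one of largest weight \<open>x u + x v = 1 + d\<close>, so that
  \<open>e\<^sub>W\<close> and the total defect together are at most \<open>k * d\<close>. The number \<open>l * (1 + d)\<close> is the weight
  of the neighbours of \<open>u\<close> plus that of the neighbours of \<open>v\<close>. It is large, so either many vertices
  of \<open>W\<close> are adjacent to both \<open>u\<close> and \<open>v\<close> or the set \<open>S\<close> of those adjacent to exactly one of them is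
  heavy. In the first case there are many triangles (\<open>card_EU_plus_common_le\<close>). The second cannot
  happen: a vertex missing \<open>u\<close> or \<open>v\<close> has a defect in proportion to its weight
  (\<open>weight_of_incomplete_vertex\<close>), so \<open>S\<close> has weight at most \<open>k + 2 e\<^sub>W\<close>. Altogether
  \<open>l + (l - 1) * d \<le> 2 t + 2 + 2 e\<^sub>W\<close>. If \<open>l\<close> were larger than \<open>2 t + 2 \<ge> 2 k + 2\<close>, then
  \<open>(l - 1) * d \<ge> 2 k d \<ge> 2 e\<^sub>W\<close> would absorb the last term, a contradiction
  (\<open>eigenvalue_le_if_edge_in_U\<close>).
\<close>

section \<open>A nonnegative eigenvector from the Rayleigh quotient\<close>

lemma finite_maximiser:
  fixes g :: "'a \<Rightarrow> real"
  assumes "finite A" "A \<noteq> {}"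
  obtains p where "p \<in> A" "\<And>q. q \<in> A \<Longrightarrow> g q \<le> g p"
  using ex_is_arg_min_if_finite[OF assms, of "\<lambda>q. - g q"] by (auto simp: is_arg_min_def not_less)

text \<open>
  The first-order condition at an extremum, in algebraic form: near \<open>s = 0\<close> the linear term
  dominates the quadratic one and changes sign.
\<close>
lemma linear_coefficient_zero:
  fixes b c :: real
  assumes "\<And>s. 2 * s * b + s\<^sup>2 * c \<le> 0"
  shows "b = 0"
proof (rule ccontr)
  assume "b \<noteq> 0"
  define s where "s = b / (\<bar>c\<bar> + 1)"
  have b: "b = s * (\<bar>c\<bar> + 1)"
    by (simp add: s_def add_nonneg_pos)
  have "s \<noteq> 0"
    using \<open>b \<noteq> 0\<close> b by auto
  have "2 * s * b + s\<^sup>2 * c = s\<^sup>2 * (2 * \<bar>c\<bar> + 2 + c)"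
    by (subst b) (simp add: algebra_simps power2_eq_square)
  moreover have "s\<^sup>2 * (2 * \<bar>c\<bar> + 2 + c) > 0"
    using \<open>s \<noteq> 0\<close> by (intro mult_pos_pos) auto
  ultimately show False
    using assms[of s] by simp
qed

text \<open>
  The quadratic form of \<open>a\<close> attains its maximum \<open>l\<close> on the unit sphere, which is compact, and
  perturbing a maximiser in one coordinate gives the eigenvalue equation there. The last conclusion,
  maximality of \<open>l\<close>, is what compares \<open>l\<close> with the moduli of all complex eigenvalues.
\<close>
lemma rayleigh_eigenvector:
  fixes a :: "'a \<Rightarrow> 'a \<Rightarrow> real"
  assumes fin: "finite V" and ne: "V \<noteq> {}"
    and sym: "\<And>u v. a u v = a v u" and nonneg: "\<And>u v. a u v \<ge> 0"
  obtains x l where "\<And>v. x v \<ge> 0" "\<exists>v\<in>V. x v \<noteq> 0"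
    "\<And>v. v \<in> V \<Longrightarrow> (\<Sum>u\<in>V. a v u * x u) = l * x v"
    "\<And>y. (\<Sum>u\<in>V. \<Sum>v\<in>V. a u v * y u * y v) \<le> l * (\<Sum>v\<in>V. (y v)\<^sup>2)"
proof -
  define Q where "Q y = (\<Sum>u\<in>V. \<Sum>v\<in>V. a u v * y u * y v)" for y :: "'a \<Rightarrow> real"
  define n where "n y = (\<Sum>v\<in>V. (y v)\<^sup>2)" for y :: "'a \<Rightarrow> real"
  \<comment> \<open>Functions vanishing outside \<open>V\<close>: among all functions the sphere need not be compact.\<close>
  define K where "K = (PiE UNIV (\<lambda>v. if v \<in> V then {-1..1} else {0}) :: ('a \<Rightarrow> real) set)"
  define S where "S = K \<inter> {y. n y = 1}"
  have "compact K"
    using compactin_PiE[of "\<lambda>_. euclidean" UNIV "\<lambda>v. if v \<in> V then {-1..1::real} else {0}"]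
    by (auto simp: K_def euclidean_product_topology)
  moreover have cont: "continuous_on UNIV Q" "continuous_on UNIV n"
    unfolding Q_def n_def by (intro continuous_intros continuous_on_product_coordinates)+
  then have "closed {y. n y = 1}"
    by (intro closed_Collect_eq) auto
  ultimately have "compact S"
    unfolding S_def by (rule compact_Int_closed)
  have unit: "(\<lambda>v. if v \<in> V then y v else 0) \<in> S" if "n y = 1" for y
  proof -
    have "\<bar>y v\<bar> \<le> 1" if "v \<in> V" for v
    proof -
      have "(y v)\<^sup>2 \<le> n y"
        unfolding n_def by (rule member_le_sum[OF that]) (use fin in auto)
      then show ?thesis
        using \<open>n y = 1\<close> by (simp add: abs_square_le_1)
    qed
    moreover have "n (\<lambda>v. if v \<in> V then y v else 0) = 1"
      using that by (simp add: n_def)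
    ultimately show ?thesis
      by (auto simp: S_def K_def abs_le_iff minus_le_iff)
  qed
  obtain w where w: "w \<in> V"
    using ne by blast
  have "n (\<lambda>v. if v = w then 1 else 0) = 1"
    using w fin by (simp add: n_def if_distrib[of "\<lambda>t. t\<^sup>2"] cong: if_cong)
  from unit[OF this] have "S \<noteq> {}"
    by blast
  then obtain z where z: "z \<in> S" "\<And>y. y \<in> S \<Longrightarrow> Q y \<le> Q z"
    using continuous_attains_sup[OF \<open>compact S\<close>] cont(1) continuous_on_subset by blast
  define l where "l = Q z"
  have scale: "Q (\<lambda>v. c * y v) = c\<^sup>2 * Q y" "n (\<lambda>v. c * y v) = c\<^sup>2 * n y" for c y
    unfolding Q_def n_def sum_distrib_left
    by (auto intro!: sum.cong simp: power2_eq_square)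
  have bound: "Q y \<le> l * n y" for y
  proof (cases "n y = 0")
    case True
    then have "y v = 0" if "v \<in> V" for v
      using that fin by (simp add: n_def sum_nonneg_eq_0_iff)
    then show ?thesis
      using True by (simp add: Q_def)
  next
    case False
    then have pos: "n y > 0"
      by (simp add: n_def sum_nonneg less_le)
    define y' where "y' v = (1 / sqrt (n y)) * y v" for v
    have "n y' = 1" "Q y' = Q y / n y"
      using pos scale[of "1 / sqrt (n y)" y] unfolding y'_def by (simp_all add: power_divide)
    moreover have "Q (\<lambda>v. if v \<in> V then y' v else 0) = Q y'"
      by (simp add: Q_def)
    ultimately have "Q y / n y \<le> l"
      using z(2)[OF unit[OF \<open>n y' = 1\<close>]] by (simp add: l_def)
    then show ?thesis
      using pos by (simp add: field_simps)
  qed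
  \<comment> \<open>Since the entries of \<open>a\<close> are nonnegative, taking absolute values preserves maximality.\<close>
  define x where "x v = \<bar>z v\<bar>" for v
  have "n x = 1"
    using z(1) by (simp add: x_def n_def S_def)
  have "Q z \<le> Q x"
    unfolding Q_def x_def
  proof (intro sum_mono)
    fix u v
    have "a u v * (z u * z v) \<le> a u v * \<bar>z u * z v\<bar>"
      by (rule mult_left_mono) (use nonneg in auto)
    then show "a u v * z u * z v \<le> a u v * \<bar>z u\<bar> * \<bar>z v\<bar>"
      by (simp add: abs_mult mult.assoc)
  qed
  then have Qx: "Q x = l"
    using bound[of x] \<open>n x = 1\<close> by (simp add: l_def)
  have eig: "(\<Sum>u\<in>V. a v u * x u) = l * x v" if v: "v \<in> V" for v
  proof -
    define b where "b = (\<Sum>u\<in>V. a v u * x u)"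
    \<comment> \<open>Maximality, tested at \<open>x\<close> perturbed by \<open>s\<close> in the coordinate \<open>v\<close>.\<close>
    have "2 * s * (b - l * x v) + s\<^sup>2 * (a v v - l) \<le> 0" for s
    proof -
      define e where "e u = (if u = v then s else 0)" for u
      have e: "(\<Sum>u\<in>V. g u * e u) = g v * s" for g
        using v fin by (simp add: e_def if_distrib[of "(*) _"] cong: if_cong)
      have left: "(\<Sum>u\<in>V. \<Sum>w\<in>V. a u w * e u * h w) = s * (\<Sum>w\<in>V. a v w * h w)" for h
      proof -
        have "(\<Sum>u\<in>V. \<Sum>w\<in>V. a u w * e u * h w) = (\<Sum>u\<in>V. (\<Sum>w\<in>V. a u w * h w) * e u)"
          unfolding sum_distrib_right by (intro sum.cong refl) (simp add: mult_ac)
        also have "\<dots> = (\<Sum>w\<in>V. a v w * h w) * s"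
          by (rule e)
        finally show ?thesis
          by (simp only: mult.commute)
      qed
      have "(\<Sum>u\<in>V. \<Sum>w\<in>V. a u w * x u * e w) = s * b"
        by (simp add: e b_def sym[of _ v] flip: sum_distrib_right)
      moreover have "(\<Sum>u\<in>V. \<Sum>w\<in>V. a u w * e u * e w) = s\<^sup>2 * a v v"
        by (subst left) (simp add: e power2_eq_square)
      moreover have "Q (\<lambda>u. x u + e u) = Q x + (\<Sum>u\<in>V. \<Sum>w\<in>V. a u w * x u * e w)
          + (\<Sum>u\<in>V. \<Sum>w\<in>V. a u w * e u * x w) + (\<Sum>u\<in>V. \<Sum>w\<in>V. a u w * e u * e w)"
        unfolding Q_def sum.distrib[symmetric] by (intro sum.cong refl) (simp add: algebra_simps)
      ultimately have "Q (\<lambda>u. x u + e u) = l + 2 * s * b + s\<^sup>2 * a v v"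
        by (simp add: Qx left b_def)
      moreover have "n (\<lambda>u. x u + e u) = n x + 2 * (\<Sum>u\<in>V. x u * e u) + (\<Sum>u\<in>V. e u * e u)"
        unfolding n_def sum_distrib_left sum.distrib[symmetric]
        by (intro sum.cong refl) (simp add: algebra_simps power2_eq_square)
      then have "n (\<lambda>u. x u + e u) = 1 + 2 * s * x v + s\<^sup>2"
        by (simp add: \<open>n x = 1\<close> e) (simp add: e_def power2_eq_square)
      ultimately show ?thesis
        using bound[of "\<lambda>u. x u + e u"] by (simp add: algebra_simps)
    qed
    from linear_coefficient_zero[OF this] show ?thesis
      by (simp add: b_def)
  qed
  have "\<exists>v\<in>V. x v \<noteq> 0"
  proof (rule ccontr)
    assume "\<not> (\<exists>v\<in>V. x v \<noteq> 0)"
    then have "n x = 0"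
      by (simp add: n_def)
    with \<open>n x = 1\<close> show False
      by simp
  qed
  with eig bound show thesis
    using that[of x l] unfolding Q_def n_def by (simp add: x_def)
qed

section \<open>Graphs given by an edge relation\<close>

lemma card_symmetric_relation:
  assumes "finite R" "sym R" "irrefl R"
  shows "card R = 2 * card ((\<lambda>(a, b). {a, b}) ` R)"
proof -
  have "card {p \<in> R. (\<lambda>(a, b). {a, b}) p = e} = 2"
    if "e \<in> (\<lambda>(a, b). {a, b}) ` R" for e
  proof -
    obtain a b where ab: "(a, b) \<in> R" "e = {a, b}"
      using \<open>e \<in> _\<close> by auto
    then have "a \<noteq> b" "(b, a) \<in> R"
      using assms(2,3) by (auto simp: irrefl_def sym_def)
    then have "{p \<in> R. (\<lambda>(a, b). {a, b}) p = e} = {(a, b), (b, a)}"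
      using ab by (auto simp: doubleton_eq_iff)
    then show ?thesis
      using \<open>a \<noteq> b\<close> by simp
  qed
  moreover have "card R = (\<Sum>e \<in> (\<lambda>(a, b). {a, b}) ` R. card {p \<in> R. (\<lambda>(a, b). {a, b}) p = e})"
    using sum.image_gen[OF assms(1), of "\<lambda>_. 1::nat" "\<lambda>(a, b). {a, b}"] by simp
  ultimately show ?thesis
    by simp
qed

locale edge_relation =
  fixes V :: "'a set" and E :: "'a rel"
  assumes finV: "finite V" and EV: "E \<subseteq> V \<times> V" and symE: "sym E" and irreflE: "irrefl E"
begin

definition adj :: "'a \<Rightarrow> 'a \<Rightarrow> real" where
  "adj u v = (if (u, v) \<in> E then 1 else 0)"

definition triangle_sets :: "'a set set" where
  "triangle_sets = {{a, b, c} | a b c. (a, b) \<in> E \<and> (b, c) \<in> E \<and> (a, c) \<in> E}"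

lemma finite_E: "finite E"
  using finite_subset[OF EV] finV by simp

lemma adj_sym: "adj u v = adj v u"
  using symE by (auto simp: adj_def sym_def)

lemma adj_bounds: "0 \<le> adj u v" "adj u v \<le> 1"
  by (auto simp: adj_def)

lemma adj_self: "adj v v = 0"
  using irreflE by (auto simp: adj_def irrefl_def)

lemma finite_triangle_sets: "finite triangle_sets"
  by (rule finite_subset[of _ "Pow V"]) (use EV finV in \<open>auto simp: triangle_sets_def\<close>)

lemma sum_adj_eq_card:
  assumes "finite A" "finite B"
  shows "(\<Sum>a\<in>A. \<Sum>b\<in>B. adj a b) = card (E \<inter> A \<times> B)"
proof -
  have "(\<Sum>a\<in>A. \<Sum>b\<in>B. adj a b) = (\<Sum>p\<in>A \<times> B. if p \<in> E then 1 else 0)"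
    by (simp add: sum.cartesian_product adj_def case_prod_beta)
  also have "\<dots> = card (A \<times> B \<inter> E)"
    using assms by (simp add: sum.If_cases)
  finally show ?thesis
    by (simp add: Int_commute)
qed

end

section \<open>The neighbourhood of a vertex of largest weight\<close>

text \<open>
  The assumption \<open>l_large\<close> says \<open>m \<le> l\<^sup>2\<close>: every edge contributes two arcs to \<open>E\<close>.
\<close>
locale scaled_eigenvector = edge_relation +
  fixes x :: "'a \<Rightarrow> real" and l :: real and r :: 'a
  assumes rV: "r \<in> V" and xr: "x r = 1"
    and x_nonneg: "\<And>v. v \<in> V \<Longrightarrow> 0 \<le> x v" and x_le: "\<And>v. v \<in> V \<Longrightarrow> x v \<le> 1"
    and eig: "\<And>v. v \<in> V \<Longrightarrow> (\<Sum>u\<in>V. adj v u * x u) = l * x v"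
    and l_pos: "l > 0" and l_large: "card E \<le> 2 * l\<^sup>2"
begin

definition U :: "'a set" where "U = {u. (r, u) \<in> E}"

definition W :: "'a set" where "W = V - U - {r}"

definition dU :: "'a \<Rightarrow> real" where "dU v = (\<Sum>u\<in>U. adj v u)"

definition dW :: "'a \<Rightarrow> real" where "dW v = (\<Sum>w\<in>W. adj v w)"

definition EU :: "'a set set" where "EU = (\<lambda>(a, b). {a, b}) ` (E \<inter> U \<times> U)"

lemma UV: "U \<subseteq> V" and WV: "W \<subseteq> V"
  using EV by (auto simp: U_def W_def)

lemma finU: "finite U" and finW: "finite W"
  using UV WV finV finite_subset by blast+

lemma r_notin: "r \<notin> U" "r \<notin> W"
  using irreflE by (auto simp: U_def W_def irrefl_def)

lemma sum_V: "(\<Sum>v\<in>V. f v) = f r + (\<Sum>u\<in>U. f u) + (\<Sum>w\<in>W. f w)" for f :: "'a \<Rightarrow> real"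
proof -
  have "V = insert r (U \<union> W)"
    using UV rV by (auto simp: W_def)
  moreover have "U \<inter> W = {}"
    by (auto simp: W_def)
  moreover have "sum f (insert r (U \<union> W)) = f r + (sum f U + sum f W)" if "U \<inter> W = {}"
    using that r_notin finU finW by (simp add: sum.union_disjoint)
  ultimately show ?thesis
    by (metis add.assoc)
qed

lemma adj_r: "u \<in> U \<Longrightarrow> adj u r = 1" "u \<in> U \<Longrightarrow> adj r u = 1"
  "w \<in> W \<Longrightarrow> adj w r = 0" "w \<in> W \<Longrightarrow> adj r w = 0"
  using adj_sym[of _ r] by (auto simp: adj_def U_def W_def)

lemma eig_r: "(\<Sum>u\<in>U. x u) = l"
  using eig[OF rV] by (simp add: sum_V adj_self adj_r xr)

lemma eig_U: "u \<in> U \<Longrightarrow> l * x u = 1 + (\<Sum>v\<in>U. adj u v * x v) + (\<Sum>w\<in>W. adj u w * x w)"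
  using eig[of u] UV by (auto simp: sum_V adj_r xr)

lemma eig_W: "w \<in> W \<Longrightarrow> l * x w = (\<Sum>u\<in>U. adj w u * x u) + (\<Sum>v\<in>W. adj w v * x v)"
  using eig[of w] WV by (auto simp: sum_V adj_r xr)

lemma x_U_pos:
  assumes "u \<in> U"
  shows "x u > 0"
proof -
  have "(\<Sum>v\<in>U. adj u v * x v) \<ge> 0" "(\<Sum>w\<in>W. adj u w * x w) \<ge> 0"
    using UV WV x_nonneg adj_bounds by (auto intro!: sum_nonneg mult_nonneg_nonneg)
  then have "l * x u > 0"
    using eig_U[OF assms] by linarith
  then show ?thesis
    using l_pos by (simp add: zero_less_mult_iff)
qed

lemma dU_nonneg: "dU v \<ge> 0" and dW_nonneg: "dW v \<ge> 0"
  by (simp_all add: dU_def dW_def sum_nonneg adj_bounds)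

lemma sum_dW_U: "(\<Sum>u\<in>U. dW u) = (\<Sum>w\<in>W. dU w)"
  unfolding dU_def dW_def by (subst sum.swap) (simp add: adj_sym)

lemma card_E: "card E = 2 * card U + (\<Sum>u\<in>U. dU u) + 2 * (\<Sum>w\<in>W. dU w) + (\<Sum>w\<in>W. dW w)"
proof -
  have "real (card E) = (\<Sum>u\<in>V. \<Sum>v\<in>V. adj u v)"
    using sum_adj_eq_card[OF finV finV] EV by (simp add: Int_absorb2)
  also have "\<dots> = card U + (\<Sum>u\<in>U. 1 + dU u + dW u) + (\<Sum>w\<in>W. dU w + dW w)"
    by (simp add: sum_V adj_self adj_r dU_def dW_def)
  finally show ?thesis
    by (simp add: sum.distrib sum_dW_U)
qed

text \<open>
  Two applications of the eigenvalue equation, the first one at \<open>r\<close>: each vertex is counted with its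
  weight once for every walk of length two from \<open>r\<close> to it.
\<close>
lemma l_square: "l\<^sup>2 = card U + (\<Sum>u\<in>U. dU u * x u) + (\<Sum>w\<in>W. dU w * x w)"
proof -
  have "l\<^sup>2 = (\<Sum>u\<in>U. l * x u)"
    by (simp add: power2_eq_square flip: eig_r sum_distrib_left)
  also have "\<dots> = card U + (\<Sum>u\<in>U. \<Sum>v\<in>U. adj u v * x v) + (\<Sum>u\<in>U. \<Sum>w\<in>W. adj u w * x w)"
    by (simp add: eig_U sum.distrib)
  also have "(\<Sum>u\<in>U. \<Sum>v\<in>U. adj u v * x v) = (\<Sum>u\<in>U. dU u * x u)"
    by (subst sum.swap) (simp add: dU_def sum_distrib_right adj_sym)
  also have "(\<Sum>u\<in>U. \<Sum>w\<in>W. adj u w * x w) = (\<Sum>w\<in>W. dU w * x w)"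
    by (subst sum.swap) (simp add: dU_def sum_distrib_right adj_sym)
  finally show ?thesis .
qed

text \<open>
  This is \<open>card E \<le> 2 * l\<^sup>2\<close> with both sides expanded by \<open>card_E\<close> and \<open>l_square\<close>. The double sum
  meets every edge inside \<open>U\<close> twice, as \<open>\<Sum>w\<in>W. dW w\<close> does with every edge inside \<open>W\<close>.
\<close>
lemma defect_inequality:
  "(\<Sum>w\<in>W. dW w) + 2 * (\<Sum>w\<in>W. dU w * (1 - x w))
     \<le> (\<Sum>u\<in>U. \<Sum>v\<in>U. adj u v * (x u + x v - 1))"
proof -
  have "(\<Sum>u\<in>U. \<Sum>v\<in>U. adj u v * (x u + x v - 1))
      = (\<Sum>u\<in>U. \<Sum>v\<in>U. adj u v * x u) + (\<Sum>u\<in>U. \<Sum>v\<in>U. adj u v * x v) - (\<Sum>u\<in>U. dU u)"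
    by (simp add: algebra_simps sum.distrib sum_subtractf dU_def)
  also have "(\<Sum>u\<in>U. \<Sum>v\<in>U. adj u v * x v) = (\<Sum>u\<in>U. \<Sum>v\<in>U. adj u v * x u)"
    by (subst sum.swap) (simp add: adj_sym)
  also have "\<dots> = (\<Sum>u\<in>U. dU u * x u)"
    by (simp add: dU_def sum_distrib_right)
  finally show ?thesis
    using l_large card_E l_square by (simp add: algebra_simps sum_subtractf)
qed

lemma defects_nonneg: "(\<Sum>w\<in>W. dW w) \<ge> 0" "(\<Sum>w\<in>W. dU w * (1 - x w)) \<ge> 0"
  using dU_nonneg dW_nonneg x_le WV by (auto intro!: sum_nonneg mult_nonneg_nonneg)

section \<open>A largest neighbourhood without edges\<close>

text \<open>
  All terms on the left of \<open>defect_inequality\<close> vanish. Hence \<open>W\<close> spans no edge, and a vertex \<open>w\<close>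
  of \<open>W\<close> with a neighbour has weight 1, the same as \<open>r\<close>. Its neighbours, which lie in \<open>U\<close>, then have
  total weight \<open>l\<close>, the weight of all of \<open>U\<close>; as weights on \<open>U\<close> are positive, none is missing.
\<close>
lemma bipartite_if_no_edges_in_U:
  assumes "E \<inter> U \<times> U = {}"
  shows "\<exists>B. finite B \<and> B \<noteq> {} \<and> B \<subseteq> V \<and> U \<noteq> {} \<and> U \<inter> B = {} \<and> E = U \<times> B \<union> B \<times> U"
proof -
  have zero: "adj u v = 0" if "u \<in> U" "v \<in> U" for u v
    using assms that by (auto simp: adj_def)
  then have "(\<Sum>u\<in>U. \<Sum>v\<in>U. adj u v * (x u + x v - 1)) = 0"
    by simp
  then have sums: "(\<Sum>w\<in>W. dW w) = 0" "(\<Sum>w\<in>W. dU w * (1 - x w)) = 0"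
    using defect_inequality defects_nonneg by linarith+
  have dW0: "dW w = 0" if "w \<in> W" for w
    using sums(1) that finW dW_nonneg by (simp add: sum_nonneg_eq_0_iff)
  have WW: "adj v w = 0" if "v \<in> W" "w \<in> W" for v w
    using dW0[OF that(1)] that finW adj_bounds by (simp add: dW_def sum_nonneg_eq_0_iff)
  have full: "adj w u = 1" if w: "w \<in> W" "dU w \<noteq> 0" and u: "u \<in> U" for w u
  proof -
    have "dU w * (1 - x w) = 0"
      using sums(2) w(1) finW dU_nonneg x_le WV
      by (subst (asm) sum_nonneg_eq_0_iff) (auto intro!: mult_nonneg_nonneg)
    then have "x w = 1"
      using w(2) by simp
    then have "(\<Sum>u\<in>U. adj w u * x u) = (\<Sum>u\<in>U. x u)"
      using eig_W[OF w(1)] WW w(1) eig_r by simp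
    then have "(\<Sum>u\<in>U. (1 - adj w u) * x u) = 0"
      by (simp add: algebra_simps sum_subtractf)
    then have "(1 - adj w u) * x u = 0"
      using u finU x_nonneg UV adj_bounds
      by (subst (asm) sum_nonneg_eq_0_iff) (auto intro!: mult_nonneg_nonneg)
    then show ?thesis
      using x_U_pos[OF u] by simp
  qed
  define B where "B = insert r {w \<in> W. dU w \<noteq> 0}"
  have "E \<subseteq> U \<times> B \<union> B \<times> U"
  proof (rule subrelI)
    fix a b
    assume ab: "(a, b) \<in> E"
    then have "(b, a) \<in> E"
      using symE by (auto simp: sym_def)
    have *: "w \<in> B" if "(w, u) \<in> E" "u \<in> U" "w \<in> W" for w u
      using that finU adj_bounds by (auto simp: B_def dU_def sum_nonneg_eq_0_iff adj_def)
    have "a = r \<or> a \<in> U \<or> a \<in> W" "b = r \<or> b \<in> U \<or> b \<in> W"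
      using ab EV by (auto simp: W_def)
    moreover have "\<not> (a \<in> U \<and> b \<in> U)"
      using ab assms by auto
    moreover have "\<not> (a \<in> W \<and> b \<in> W)"
      using WW[of a b] ab by (auto simp: adj_def)
    moreover have "b \<in> U" if "a = r"
      using that ab by (simp add: U_def)
    moreover have "a \<in> U" if "b = r"
      using that \<open>(b, a) \<in> E\<close> by (simp add: U_def)
    moreover have "r \<in> B"
      by (simp add: B_def)
    ultimately show "(a, b) \<in> U \<times> B \<union> B \<times> U"
      using *[OF ab] *[OF \<open>(b, a) \<in> E\<close>] by blast
  qed
  moreover have "(w, u) \<in> E \<and> (u, w) \<in> E" if "w \<in> B" "u \<in> U" for w u
  proof -
    have "adj w u = 1"
      using that full adj_r by (auto simp: B_def)
    then show ?thesis
      using adj_sym[of w u] by (auto simp: adj_def split: if_splits)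
  qed
  moreover have "U \<noteq> {}"
    using eig_r l_pos by auto
  moreover have "U \<inter> B = {}"
    using r_notin by (auto simp: B_def W_def)
  moreover have "finite B" "B \<subseteq> V" "B \<noteq> {}"
    using finW WV rV by (auto simp: B_def)
  ultimately show ?thesis
    by blast
qed

section \<open>A largest neighbourhood with an edge\<close>

lemma finite_EU: "finite EU"
  using finite_E by (simp add: EU_def)

lemma card_arcs_U: "(\<Sum>u\<in>U. \<Sum>v\<in>U. adj u v) = 2 * card EU"
proof -
  have "sym (E \<inter> U \<times> U)" "irrefl (E \<inter> U \<times> U)"
    using symE irreflE by (auto simp: sym_def irrefl_def)
  from card_symmetric_relation[OF _ this] show ?thesis
    using finite_E finU by (simp add: sum_adj_eq_card EU_def)
qed

text \<open>
  An edge inside \<open>U\<close> forms a triangle with \<open>r\<close>, a common neighbour of \<open>u\<close> and \<open>v\<close> in \<open>W\<close> forms one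
  with \<open>u\<close> and \<open>v\<close>, and the latter avoids \<open>r\<close>.
\<close>
lemma card_EU_plus_common_le:
  assumes "u \<in> U" "v \<in> U" "(u, v) \<in> E"
  shows "card EU + card {w \<in> W. (u, w) \<in> E \<and> (v, w) \<in> E} \<le> card triangle_sets"
proof -
  let ?C = "{w \<in> W. (u, w) \<in> E \<and> (v, w) \<in> E}"
  let ?f = "\<lambda>w. {u, v, w}"
  have "inj_on (insert r) EU"
  proof (rule inj_onI)
    fix A B
    assume AB: "A \<in> EU" "B \<in> EU" "insert r A = insert r B"
    then have "r \<notin> A" "r \<notin> B"
      using r_notin by (auto simp: EU_def)
    then show "A = B"
      using AB(3) by (simp add: insert_ident)
  qed
  moreover have "inj_on ?f ?C"
    using assms by (auto simp: inj_on_def W_def)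
  moreover have "r \<notin> ?f w" if "w \<in> ?C" for w
    using assms that r_notin by auto
  then have "insert r ` EU \<inter> ?f ` ?C = {}"
    by blast
  ultimately have "card EU + card ?C = card (insert r ` EU \<union> ?f ` ?C)"
    using finite_EU finW by (simp add: card_Un_disjoint card_image)
  also have "\<dots> \<le> card triangle_sets"
  proof (rule card_mono[OF finite_triangle_sets])
    show "insert r ` EU \<union> ?f ` ?C \<subseteq> triangle_sets"
      using assms by (force simp: triangle_sets_def EU_def U_def)
  qed
  finally show ?thesis .
qed

lemma dU_eq_card: "dU v = card {y \<in> U. (v, y) \<in> E}"
  unfolding dU_def adj_def using finU by (simp add: sum.If_cases Int_def)

text \<open>
  The edges inside \<open>U\<close> that meet \<open>u\<close> or \<open>v\<close> are counted once each, except \<open>uv\<close>, counted twice.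
\<close>
lemma dU_plus_dU_le:
  assumes "u \<in> U" "v \<in> U" "(u, v) \<in> E"
  shows "dU u + dU v \<le> card EU + 1"
proof -
  let ?A = "{y \<in> U. (u, y) \<in> E}" and ?B = "{y \<in> U. (v, y) \<in> E}"
  have "(v, u) \<in> E" "u \<noteq> v"
    using assms(3) symE irreflE by (auto simp: sym_def irrefl_def)
  have fin: "finite ?A" "finite ?B"
    using finU by auto
  have "card ?B = card (?B - {u}) + 1"
    using card.remove[of ?B u] fin \<open>(v, u) \<in> E\<close> assms(1) by auto
  moreover have "card ?A + card (?B - {u}) = card ((\<lambda>y. {u, y}) ` ?A \<union> (\<lambda>y. {v, y}) ` (?B - {u}))"
  proof -
    have "inj_on (\<lambda>y. {u, y}) ?A" "inj_on (\<lambda>y. {v, y}) (?B - {u})"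
      by (auto simp: inj_on_def doubleton_eq_iff)
    moreover have "(\<lambda>y. {u, y}) ` ?A \<inter> (\<lambda>y. {v, y}) ` (?B - {u}) = {}"
      using \<open>u \<noteq> v\<close> by (auto simp: doubleton_eq_iff)
    ultimately show ?thesis
      using fin by (simp add: card_Un_disjoint card_image)
  qed
  moreover have "card ((\<lambda>y. {u, y}) ` ?A \<union> (\<lambda>y. {v, y}) ` (?B - {u})) \<le> card EU"
    by (rule card_mono[OF finite_EU]) (use assms in \<open>auto simp: EU_def\<close>)
  ultimately show ?thesis
    by (simp add: dU_eq_card)
qed

text \<open>
  If \<open>w\<close> has no neighbour in \<open>W\<close>, then \<open>l * x w\<close> is the weight of its neighbours in \<open>U\<close>. Since \<open>U\<close>
  has weight \<open>l\<close>, missing \<open>u\<close> costs \<open>l * (1 - x w) \<ge> x u\<close>; on the other hand \<open>dU w \<ge> l * x w\<close>.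
  Multiplied and divided by \<open>l\<close>, the two bounds give the claim. If \<open>w\<close> has a neighbour in \<open>W\<close>, the last
  term alone suffices.
\<close>
lemma weight_of_incomplete_vertex:
  assumes w: "w \<in> W" and u: "u \<in> U" "adj w u = 0" and mu: "mu \<le> x u" "0 \<le> mu"
  shows "mu * x w \<le> dU w * (1 - x w) + mu * dW w"
proof (cases "dW w = 0")
  case True
  then have "adj w v = 0" if "v \<in> W" for v
    using that finW adj_bounds by (simp add: dW_def sum_nonneg_eq_0_iff)
  then have lx: "l * x w = (\<Sum>v\<in>U. adj w v * x v)"
    using eig_W[OF w] by simp
  have "l * x w \<le> dU w"
    unfolding lx dU_def
    using x_le UV adj_bounds by (intro sum_mono) (auto intro!: mult_left_le)
  have "x u = (1 - adj w u) * x u"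
    using u by simp
  also have "\<dots> \<le> (\<Sum>v\<in>U. (1 - adj w v) * x v)"
    using u finU x_nonneg UV adj_bounds by (intro member_le_sum) (auto intro!: mult_nonneg_nonneg)
  also have "\<dots> = l - l * x w"
    by (simp add: lx left_diff_distrib sum_subtractf eig_r)
  finally have mu_le: "mu \<le> l * (1 - x w)"
    using mu by (simp add: algebra_simps)
  have xw: "0 \<le> x w" "x w \<le> 1"
    using w WV x_nonneg x_le by auto
  have "mu * x w \<le> l * (1 - x w) * x w"
    using mu_le xw by (intro mult_right_mono)
  also have "\<dots> = (l * x w) * (1 - x w)"
    by simp
  also have "\<dots> \<le> dU w * (1 - x w)"
    using \<open>l * x w \<le> dU w\<close> xw by (intro mult_right_mono) auto
  finally show ?thesis
    using True by simp
next
  case False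
  have "dW w = card {v \<in> W. (w, v) \<in> E}"
    unfolding dW_def adj_def using finW by (simp add: sum.If_cases Int_def)
  then have "1 \<le> dW w"
    using False by simp
  moreover have "0 \<le> x w" "x w \<le> 1"
    using w WV x_nonneg x_le by auto
  ultimately have "mu * x w \<le> mu * dW w" "0 \<le> dU w * (1 - x w)"
    using mu dU_nonneg by (auto intro!: mult_left_mono mult_nonneg_nonneg)
  then show ?thesis
    by linarith
qed

text \<open>
  The heart of the argument: triangles through a heaviest edge \<open>uv\<close> inside \<open>U\<close>. Edges
  inside \<open>W\<close> weaken the upper bound on \<open>l\<close> by \<open>F\<close>, but by \<open>defect_inequality\<close> they can exist only
  if \<open>d\<close> is large, and then the surplus \<open>(l - 1) * d\<close> makes up for \<open>F\<close>.
\<close>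
lemma eigenvalue_le_if_edge_in_U:
  assumes "E \<inter> U \<times> U \<noteq> {}"
  shows "l \<le> 2 * card triangle_sets + 2"
proof (rule ccontr)
  define t k where "t = real (card triangle_sets)" and "k = real (card EU)"
  define F where "F = (\<Sum>w\<in>W. dW w)"
  assume "\<not> l \<le> 2 * card triangle_sets + 2"
  then have l_gt: "l > 2 * t + 2"
    by (simp add: t_def)
  define A where "A = E \<inter> U \<times> U"
  have A: "finite A" "A \<noteq> {}"
    using assms finite_E by (auto simp: A_def)
  \<comment> \<open>A heaviest edge inside \<open>U\<close>.\<close>
  obtain p where p: "p \<in> A" "\<And>q. q \<in> A \<Longrightarrow> x (fst q) + x (snd q) \<le> x (fst p) + x (snd p)"
    using finite_maximiser[OF A, of "\<lambda>p. x (fst p) + x (snd p)"] by blast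
  obtain u v where "p = (u, v)"
    by (cases p)
  with p have uv: "(u, v) \<in> A" and "\<And>q. q \<in> A \<Longrightarrow> x (fst q) + x (snd q) \<le> x u + x v"
    by auto
  then have max: "x a + x b \<le> x u + x v" if "a \<in> U" "b \<in> U" "(a, b) \<in> E" for a b
    using that unfolding A_def by fastforce
  define d where "d = x u + x v - 1"
  have u: "u \<in> U" and v: "v \<in> U" and uvE: "(u, v) \<in> E"
    using uv by (auto simp: A_def)
  have "(\<Sum>a\<in>U. \<Sum>b\<in>U. adj a b * (x a + x b - 1)) \<le> (\<Sum>a\<in>U. \<Sum>b\<in>U. adj a b * d)"
  proof (intro sum_mono)
    fix a b
    assume "a \<in> U" "b \<in> U"
    then show "adj a b * (x a + x b - 1) \<le> adj a b * d"
      using max[of a b] by (simp add: adj_def d_def)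
  qed
  also have "\<dots> = 2 * k * d"
    using card_arcs_U by (simp add: k_def flip: sum_distrib_right)
  finally have defect: "F + 2 * (\<Sum>w\<in>W. dU w * (1 - x w)) \<le> 2 * k * d"
    using defect_inequality by (simp add: F_def)
  have F0: "F \<ge> 0"
    using defects_nonneg by (simp add: F_def)
  have "{u, v} \<in> EU"
    using u v uvE by (force simp: EU_def)
  then have k1: "k \<ge> 1"
    using finite_EU by (auto simp: k_def Suc_le_eq card_gt_0_iff)
  have "2 * k * d \<ge> 0"
    using defect F0 defects_nonneg by linarith
  then have d0: "d \<ge> 0"
    using k1 by (simp add: zero_le_mult_iff)

  define C where "C = {w \<in> W. (u, w) \<in> E \<and> (v, w) \<in> E}"
  define S where "S = {w \<in> W. ((u, w) \<in> E) \<noteq> ((v, w) \<in> E)}"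
  have "k + card C \<le> t"
    using card_EU_plus_common_le[OF u v uvE] unfolding k_def t_def C_def by linarith
  \<comment> \<open>The bound \<open>k + F\<close> on the weight of \<open>S\<close> comes from dividing by \<open>mu\<close> rather than by \<open>d\<close>, which may
    be 0.\<close>
  define mu where "mu = min (x u) (x v)"
  have mu: "mu > 0" "d \<le> mu"
    using x_U_pos u v x_le UV by (auto simp: mu_def d_def min_def)
  have SW: "S \<subseteq> W"
    by (auto simp: S_def)
  have "mu * (\<Sum>w\<in>S. x w) \<le> (\<Sum>w\<in>S. dU w * (1 - x w) + mu * dW w)"
    unfolding sum_distrib_left
  proof (intro sum_mono)
    fix w
    assume w: "w \<in> S"
    then obtain y where "y \<in> {u, v}" "(y, w) \<notin> E"
      by (auto simp: S_def)
    then have "y \<in> U" "adj w y = 0" "mu \<le> x y"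
      using u v adj_sym[of w y] by (auto simp: adj_def mu_def)
    then show "mu * x w \<le> dU w * (1 - x w) + mu * dW w"
      using weight_of_incomplete_vertex[of w y mu] w mu(1) SW by auto
  qed
  also have "\<dots> \<le> (\<Sum>w\<in>W. dU w * (1 - x w) + mu * dW w)"
    using SW finW dU_nonneg dW_nonneg x_le WV mu
    by (intro sum_mono2) (auto intro!: add_nonneg_nonneg mult_nonneg_nonneg)
  also have "\<dots> = (\<Sum>w\<in>W. dU w * (1 - x w)) + mu * F"
    by (simp add: sum.distrib F_def sum_distrib_left)
  also have "\<dots> \<le> k * d + mu * F"
    using defect F0 by linarith
  also have "\<dots> \<le> mu * (k + F)"
    using mu k1 by (simp add: algebra_simps)
  finally have S_le: "(\<Sum>w\<in>S. x w) \<le> k + F"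
    using mu(1) by simp

  \<comment> \<open>All neighbours in \<open>U\<close> are counted with weight 1, except the other end of the edge, which keeps
    its weight: this lets the factor \<open>l - 1\<close> instead of \<open>l\<close> appear in front of \<open>d\<close> below.\<close>
  have nbr_U: "(\<Sum>y\<in>U. adj a y * x y) \<le> x b + dU a - 1" if "a \<in> U" "b \<in> U" "(a, b) \<in> E" for a b
  proof -
    have "1 - x b = adj a b * (1 - x b)"
      using that by (simp add: adj_def)
    also have "\<dots> \<le> (\<Sum>y\<in>U. adj a y * (1 - x y))"
      using that finU x_le UV adj_bounds by (intro member_le_sum) (auto intro!: mult_nonneg_nonneg)
    finally show ?thesis
      by (simp add: dU_def right_diff_distrib sum_subtractf)
  qed
  have "(v, u) \<in> E"
    using uvE symE by (auto simp: sym_def)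
  have "(\<Sum>w\<in>W. adj u w * x w) + (\<Sum>w\<in>W. adj v w * x w)
      = (\<Sum>w\<in>W. (if w \<in> C then 2 * x w else 0) + (if w \<in> S then x w else 0))"
    unfolding sum.distrib[symmetric] by (intro sum.cong) (auto simp: C_def S_def adj_def)
  also have "\<dots> = (\<Sum>w\<in>C. 2 * x w) + (\<Sum>w\<in>S. x w)"
  proof -
    have "W \<inter> C = C" "W \<inter> S = S"
      by (auto simp: C_def S_def)
    then show ?thesis
      using finW by (simp add: sum.distrib flip: sum.inter_restrict)
  qed
  also have "(\<Sum>w\<in>C. 2 * x w) \<le> 2 * card C"
    using sum_bounded_above[of C "\<lambda>w. 2 * x w" 2] x_le WV by (force simp: C_def)
  finally have "l * x u + l * x v \<le> 2 + (x v + dU u - 1) + (x u + dU v - 1) + 2 * card C + (k + F)"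
    using eig_U[OF u] eig_U[OF v] nbr_U[OF u v uvE] nbr_U[OF v u \<open>(v, u) \<in> E\<close>] S_le by linarith
  also have "\<dots> \<le> d + 2 * t + 2 + F"
    using dU_plus_dU_le[OF u v uvE] \<open>k + card C \<le> t\<close> unfolding d_def k_def by linarith
  also have "l * x u + l * x v = l + l * d"
    by (simp add: d_def algebra_simps)
  finally have upper: "l + (l - 1) * d \<le> 2 * t + 2 + F"
    by (simp add: algebra_simps)
  have "F \<le> (2 * k) * d"
    using defect defects_nonneg by linarith
  also have "\<dots> \<le> (l - 1) * d"
    using d0 l_gt \<open>k + card C \<le> t\<close> by (intro mult_right_mono) auto
  finally show False
    using upper l_gt by linarith
qed

end

section \<open>From the spectral radius to the scaled eigenvector\<close>

text \<open>
  Taking absolute values in a complex eigenvector can only increase the modulus of its Rayleigh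
  quotient, so the maximal quotient \<open>l\<close> is at least the modulus of its eigenvalue, and \<open>m \<le> l\<^sup>2\<close> follows.
\<close>
lemma (in edge_relation) dominating_eigenvector:
  fixes f :: "'a \<Rightarrow> complex" and k :: complex
  assumes f: "\<exists>v\<in>V. f v \<noteq> 0"
    "\<And>v. v \<in> V \<Longrightarrow> (\<Sum>u\<in>V. (if (v, u) \<in> E then 1 else 0) * f u) = k * f v"
    and k: "norm k > 0" "card E \<le> 2 * (norm k)\<^sup>2"
  obtains x l r where "scaled_eigenvector V E x l r" "norm k \<le> l"
proof -
  have "V \<noteq> {}"
    using f(1) by blast
  from rayleigh_eigenvector[of V adj, OF finV this adj_sym adj_bounds(1)]
  obtain z l where z: "\<And>v. z v \<ge> 0" "\<exists>v\<in>V. z v \<noteq> 0"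
    "\<And>v. v \<in> V \<Longrightarrow> (\<Sum>u\<in>V. adj v u * z u) = l * z v"
    and ray: "\<And>y. (\<Sum>u\<in>V. \<Sum>v\<in>V. adj u v * y u * y v) \<le> l * (\<Sum>v\<in>V. (y v)\<^sup>2)"
    by blast
  obtain r where r: "r \<in> V" "\<And>v. v \<in> V \<Longrightarrow> z v \<le> z r"
    using finite_maximiser[OF finV \<open>V \<noteq> {}\<close>, of z] by blast
  obtain w where "w \<in> V" "z w \<noteq> 0"
    using z(2) by blast
  then have "z r > 0"
    using z(1)[of w] r(2)[of w] by linarith
  have "norm k * (\<Sum>v\<in>V. (norm (f v))\<^sup>2) \<le> (\<Sum>u\<in>V. \<Sum>v\<in>V. adj u v * norm (f u) * norm (f v))"
    unfolding sum_distrib_left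
  proof (rule sum_mono)
    fix v
    assume "v \<in> V"
    then have "norm k * norm (f v) = norm (\<Sum>u\<in>V. (if (v, u) \<in> E then 1 else 0) * f u)"
      by (simp add: f(2) norm_mult)
    also have "\<dots> \<le> (\<Sum>u\<in>V. adj v u * norm (f u))"
      by (rule sum_norm_le) (simp add: adj_def norm_mult)
    finally have "norm (f v) * (norm k * norm (f v)) \<le> norm (f v) * (\<Sum>u\<in>V. adj v u * norm (f u))"
      by (intro mult_left_mono) auto
    then show "norm k * (norm (f v))\<^sup>2 \<le> (\<Sum>u\<in>V. adj v u * norm (f v) * norm (f u))"
      by (simp add: power2_eq_square sum_distrib_left mult_ac)
  qed
  also have "\<dots> \<le> l * (\<Sum>v\<in>V. (norm (f v))\<^sup>2)"
    by (rule ray)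
  finally have "norm k \<le> l"
  proof (rule mult_right_le_imp_le)
    show "(\<Sum>v\<in>V. (norm (f v))\<^sup>2) > 0"
      using f(1) finV by (auto intro: sum_pos2)
  qed
  then have "(norm k)\<^sup>2 \<le> l\<^sup>2"
    by (intro power_mono) auto
  then have "l > 0" "card E \<le> 2 * l\<^sup>2"
    using k \<open>norm k \<le> l\<close> by linarith+
  then have "scaled_eigenvector V E (\<lambda>v. z v / z r) l r"
    using r z \<open>z r > 0\<close> by unfold_locales (auto simp flip: sum_divide_distrib)
  then show thesis
    using that \<open>norm k \<le> l\<close> by blast
qed

lemma edge_relation_pair_graph:
  assumes "pair_graph G"
  shows "edge_relation (pverts G) (parcs G)"
proof -
  interpret pair_graph G by fact
  have "irrefl (parcs G)"
    using pair_no_loops by (fastforce intro: irreflI)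
  then show ?thesis
    using pair_finite_verts in_arcsD1 in_arcsD2 pair_sym_arcs
    by unfold_locales (auto simp: symmetric_def)
qed

text \<open>
  A triangle of \<open>G\<close> is a subgraph, and the complete graphs on different vertex sets are different.
\<close>
lemma triangle_sets_le_triangles:
  assumes "pair_graph G"
  shows "card (edge_relation.triangle_sets (parcs G)) \<le> card (triangles G)"
proof -
  interpret pair_graph G by fact
  interpret edge_relation "pverts G" "parcs G" by (rule edge_relation_pair_graph) fact
  let ?K = "\<lambda>t. \<lparr>pverts = t, parcs = {(u, v). (u, v) \<in> t \<times> t \<and> u \<noteq> v}\<rparr>"
  have "card (?K ` triangle_sets) \<le> card (triangles G)"
  proof (rule card_mono)
    have "triangles G \<subseteq> (\<lambda>(A, B). \<lparr>pverts = A, parcs = B\<rparr>) ` (Pow (pverts G) \<times> Pow (parcs G))"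
    proof
      fix H
      assume "H \<in> triangles G"
      then have "H = \<lparr>pverts = pverts H, parcs = parcs H\<rparr>"
        "(pverts H, parcs H) \<in> Pow (pverts G) \<times> Pow (parcs G)"
        by (auto simp: triangles_def subgraph_def)
      then show "H \<in> (\<lambda>(A, B). \<lparr>pverts = A, parcs = B\<rparr>) ` (Pow (pverts G) \<times> Pow (parcs G))"
        by (metis (mono_tags, lifting) case_prod_conv image_eqI)
    qed
    then show "finite (triangles G)"
      by (rule finite_subset) (simp add: pair_finite_verts pair_finite_arcs)
    show "?K ` triangle_sets \<subseteq> triangles G"
    proof (rule image_subsetI)
      fix t
      assume "t \<in> triangle_sets"
      then obtain a b c where t: "t = {a, b, c}"
        and abc: "(a, b) \<in> parcs G" "(b, c) \<in> parcs G" "(a, c) \<in> parcs G"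
        by (auto simp: triangle_sets_def)
      then have rev: "(b, a) \<in> parcs G" "(c, b) \<in> parcs G" "(c, a) \<in> parcs G"
        using symE by (auto simp: sym_def)
      have "a \<noteq> b" "b \<noteq> c" "a \<noteq> c"
        using abc irreflE by (auto simp: irrefl_def)
      then have K: "complete_digraph 3 (with_proj (?K t))"
        by (auto simp: complete_digraph_pair_def t)
      then have "wf_digraph (with_proj (?K t))"
        by (auto simp: complete_digraph_def graph_def digraph_def fin_digraph_def)
      moreover have "pverts (?K t) \<subseteq> pverts G" "parcs (?K t) \<subseteq> parcs G"
        using abc rev EV by (auto simp: t)
      ultimately show "?K t \<in> triangles G"
        using K wf_digraph_axioms by (simp add: triangles_def subgraph_def compatible_def)
    qed
  qed
  moreover have "inj_on ?K triangle_sets"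
    by (auto simp: inj_on_def)
  ultimately show ?thesis
    by (simp add: card_image)
qed

theorem theorem6:
  fixes G :: "'a pair_pre_digraph" and m :: nat
  assumes "pair_graph G"
    and "card (edges G) = m"
    and "graph_spectral_radius G \<ge> sqrt (real m)"
    and "\<not> complete_bipartite_plus_isolated G"
  shows "int (card (triangles G)) \<ge> \<lfloor>(sqrt (real m) - 1) / 2\<rfloor>"
proof (cases "m = 0")
  \<comment> \<open>The bound is \<open>-1\<close>; a graph without vertices has no eigenvalue to start from.\<close>
  case True
  then show ?thesis
    by (simp add: floor_le_iff)
next
  case False
  interpret pair_graph G by fact
  interpret edge_relation "pverts G" "parcs G" by (rule edge_relation_pair_graph) fact
  have "edges G = (\<lambda>(a, b). {a, b}) ` parcs G"
    by (auto simp: edges_def)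
  then have card_arcs: "card (parcs G) = 2 * m"
    using card_symmetric_relation[OF finite_E symE irreflE] assms(2) by simp
  obtain vs where vs: "distinct vs" "set vs = pverts G"
    using finite_distinct_list[OF finV] by blast
  have "pverts G \<noteq> {}"
    using card_arcs False EV by auto
  then have "length vs > 0"
    using vs by auto
  then obtain k where k: "eigenvalue (adjacency_mat vs G) k" "norm k = graph_spectral_radius G"
    using spectral_radius_mem_max(1)[of "adjacency_mat vs G" "length vs"]
    by (auto simp: graph_spectral_radius_eq[OF vs] spectrum_def adjacency_mat_def)
  then obtain f where f: "\<exists>v\<in>pverts G. f v \<noteq> 0"
    "\<And>v. v \<in> pverts G \<Longrightarrow> (\<Sum>u\<in>pverts G. (if (v, u) \<in> parcs G then 1 else 0) * f u) = k * f v"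
    unfolding eigenvalue_adjacency_mat_iff[OF vs] by blast
  have k_ge: "sqrt m \<le> norm k"
    using assms(3) k(2) by simp
  have "norm k > 0"
    by (rule less_le_trans[OF _ k_ge]) (use False in simp)
  moreover have "m \<le> (norm k)\<^sup>2"
    using k_ge by (rule sqrt_le_D)
  ultimately obtain x l r where "scaled_eigenvector (pverts G) (parcs G) x l r" and "norm k \<le> l"
    using dominating_eigenvector[OF f] card_arcs by auto
  then interpret scaled_eigenvector "pverts G" "parcs G" x l r
    by blast
  have l_ge: "sqrt m \<le> l"
    using k_ge \<open>norm k \<le> l\<close> by linarith
  have "parcs G \<inter> U \<times> U \<noteq> {}"
  proof
    assume "parcs G \<inter> U \<times> U = {}"
    from bipartite_if_no_edges_in_U[OF this] obtain B where B: "finite B" "B \<noteq> {}" "B \<subseteq> pverts G"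
      "U \<noteq> {}" "U \<inter> B = {}" "parcs G = U \<times> B \<union> B \<times> U"
      by blast
    let ?H = "\<lparr>pverts = U \<union> B, parcs = parcs G\<rparr>"
    have "complete_bipartite_digraph (card U) (card B) (with_proj ?H)"
      using B finU by (auto simp: complete_bipartite_digraph_pair_def)
    moreover have "card U \<ge> 1" "card B \<ge> 1"
      using B finU by (simp_all add: Suc_le_eq card_gt_0_iff)
    ultimately have "complete_bipartite_plus_isolated G"
      unfolding complete_bipartite_plus_isolated_def using B(3) UV
      by (intro exI[of _ "card U"] exI[of _ "card B"] exI[of _ ?H]) auto
    with assms(4) show False ..
  qed
  then have "sqrt m \<le> 2 * real (card triangle_sets) + 2"
    using eigenvalue_le_if_edge_in_U l_ge by simp
  moreover have "real (card triangle_sets) \<le> real (card (triangles G))"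
    unfolding of_nat_le_iff by (rule triangle_sets_le_triangles[OF assms(1)])
  ultimately have "sqrt m < 2 * real (card (triangles G)) + 3"
    by linarith
  then have "(sqrt m - 1) / 2 < real (card (triangles G)) + 1"
    by simp
  then show ?thesis
    by (simp add: floor_le_iff)
qed

end
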